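(* Let $(V,\mathcal{E})$ be a finite $3$-uniform hypergraph with at least two vertices in which no four vertices induce exactly one or exactly three hyperedges. Then $(V,\mathcal{E})$ has the De Bruijn–Erdős property: either it has at least $|V|$ distinct lines, or one of its lines equals $V$.
   Context: A $3$-uniform hypergraph $(V,\mathcal{E})$ has all hyperedges of size three. For distinct vertices $u,v$, the line $\overline{uv}$ is the set consisting of $u$, $v$, and all $w$ with $\{u,v,w\}\in\mathcal{E}$. Four distinct vertices induce $k$ hyperedges if exactly $k$ of the hyperedges are subsets of those four vertices. *)

theory Defs
  imports Main
begin

definition uniform3_hypergraph :: "'a set \<Rightarrow> 'a set set \<Rightarrow> bool" where
  "uniform3_hypergraph V E \<longleftrightarrow> (\<forall>e\<in>E. e \<subseteq> V \<and> card e = 3)"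

(* Meant for u \<noteq> v only. If all hyperedges have three elements and u \<noteq> v, then
   {u, v, w} \<in> E forces w to be distinct from u and v. *)
definition hline :: "'a set set \<Rightarrow> 'a \<Rightarrow> 'a \<Rightarrow> 'a set" where
  "hline E u v = {u, v} \<union> {w. {u, v, w} \<in> E}"

definition hlines :: "'a set \<Rightarrow> 'a set set \<Rightarrow> 'a set set" where
  "hlines V E = {hline E u v | u v. u \<in> V \<and> v \<in> V \<and> u \<noteq> v}"

definition induced_hyperedges :: "'a set set \<Rightarrow> 'a set \<Rightarrow> 'a set set" where
  "induced_hyperedges E S = {e \<in> E. e \<subseteq> S}"

definition de_bruijn_erdos_property :: "'a set \<Rightarrow> 'a set set \<Rightarrow> bool" where
  "de_bruijn_erdos_property V E \<longleftrightarrow> card (hlines V E) \<ge> card V \<or> V \<in> hlines V E"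

end

(* If two lines uv and uw through a common vertex u coincide, then uvw is a hyperedge, and evenness
   on each {u, v, w, x} forces vwx to be a hyperedge, so the line vw is everything. Hence, if no line
   equals V, then each vertex u lies on |V| - 1 distinct lines uv. If these were all the lines, for
   every u, then any line would contain every vertex. *)
theory Submission
  imports Defs
begin

text \<open>A triple among four points is determined by the one point it omits.\<close>

lemma card_3_subset_four_points:
  assumes "distinct [u, v, w, x]"
  shows "{e. card e = 3 \<and> e \<subseteq> {u, v, w, x}} = {{u, v, w}, {u, v, x}, {u, w, x}, {v, w, x}}"
    (is "?L = ?R")
proof
  show "?R \<subseteq> ?L"
    using assms by auto
  show "?L \<subseteq> ?R"
  proof
    fix e assume e: "e \<in> ?L"
    have "card ({u, v, w, x} - e) = 1"
      using e assms by (subst card_Diff_subset) (auto intro: finite_subset)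
    then obtain y where y: "{u, v, w, x} - e = {y}"
      by (auto simp: card_1_singleton_iff)
    then have "e = {u, v, w, x} - {y}" and "y \<in> {u, v, w, x}"
      using e by auto
    then show "e \<in> ?R"
      using assms by auto
  qed
qed

text \<open>Parity: \<open>{u, v, w}\<close> counts once, and the two triples containing both
  \<open>u\<close> and \<open>x\<close> together count zero or two. Without \<open>{v, w, x}\<close>
  the total would be 1 or 3.\<close>

lemma fourth_triple_hyperedge:
  assumes E: "uniform3_hypergraph V E"
    and even: "card (induced_hyperedges E {u, v, w, x}) \<notin> {1, 3}"
    and distinct: "distinct [u, v, w, x]"
    and uvw: "{u, v, w} \<in> E"
    and eq: "{u, v, x} \<in> E \<longleftrightarrow> {u, w, x} \<in> E"
  shows "{v, w, x} \<in> E"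
proof (rule ccontr)
  assume vwx: "{v, w, x} \<notin> E"
  have "induced_hyperedges E {u, v, w, x} = E \<inter> {{u, v, w}, {u, v, x}, {u, w, x}, {v, w, x}}"
    unfolding card_3_subset_four_points[OF distinct, symmetric]
    using E by (auto simp: induced_hyperedges_def uniform3_hypergraph_def)
  also have "\<dots> = (if {u, v, x} \<in> E then {{u, v, w}, {u, v, x}, {u, w, x}} else {{u, v, w}})"
    using uvw eq vwx by auto
  finally have ind: "induced_hyperedges E {u, v, w, x} = \<dots>" .
  \<comment> \<open>The three triples must be pairwise different for the enumerated set to have size
    exactly 3.\<close>
  have "distinct [{u, v, w}, {u, v, x}, {u, w, x}]"
    using distinct by (auto simp: set_eq_iff)
  then have "card (induced_hyperedges E {u, v, w, x}) = (if {u, v, x} \<in> E then 3 else 1)"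
    unfolding ind by auto
  then show False
    using even by (auto split: if_splits)
qed

lemma hline_subset:
  assumes "uniform3_hypergraph V E" and "u \<in> V" and "v \<in> V"
  shows "hline E u v \<subseteq> V"
  using assms by (auto simp: hline_def uniform3_hypergraph_def)

lemma hline_eq_imp_universal:
  assumes E: "uniform3_hypergraph V E"
    and even: "\<And>S. S \<subseteq> V \<Longrightarrow> card S = 4 \<Longrightarrow> card (induced_hyperedges E S) \<notin> {1, 3}"
    and V: "u \<in> V" "v \<in> V" "w \<in> V"
    and neq: "u \<noteq> v" "u \<noteq> w" "v \<noteq> w"
    and eq: "hline E u v = hline E u w"
  shows "hline E v w = V"
proof
  show "hline E v w \<subseteq> V"
    using E V by (intro hline_subset)
  \<comment> \<open>\<open>w\<close> lies on the line \<open>uw\<close>, hence on \<open>uv\<close>;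
    being neither \<open>u\<close> nor \<open>v\<close>, it can lie there only through a
    hyperedge.\<close>
  have uvw: "{u, v, w} \<in> E"
    using eq neq by (auto simp: hline_def)
  show "V \<subseteq> hline E v w"
  proof
    fix x assume x: "x \<in> V"
    have "{v, w, x} \<in> E" if "x \<notin> {u, v, w}"
    proof (rule fourth_triple_hyperedge[OF E _ _ uvw])
      show "distinct [u, v, w, x]"
        using that neq by auto
      then show "card (induced_hyperedges E {u, v, w, x}) \<notin> {1, 3}"
        using V x by (intro even) auto
      \<comment> \<open>For \<open>x\<close> outside \<open>{u, v, w}\<close>, membership in either
        line means exactly that the corresponding triple is a hyperedge, so equality of the lines
        gives the required equivalence.\<close>
      have "x \<in> hline E u v \<longleftrightarrow> x \<in> hline E u w"
        using eq by simp
      then show "{u, v, x} \<in> E \<longleftrightarrow> {u, w, x} \<in> E"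
        using that by (simp add: hline_def)
    qed
    moreover have "{v, w, u} \<in> E"
      using uvw by (simp add: insert_commute)
    ultimately show "x \<in> hline E v w"
      by (auto simp: hline_def)
  qed
qed

theorem theorem5:
  fixes V :: "'a set" and E :: "'a set set"
  assumes "finite V"
    and "uniform3_hypergraph V E"
    and "card V \<ge> 2"
    and "\<And>S. S \<subseteq> V \<Longrightarrow> card S = 4 \<Longrightarrow>
           card (induced_hyperedges E S) \<noteq> 1 \<and> card (induced_hyperedges E S) \<noteq> 3"
  shows "de_bruijn_erdos_property V E"
proof (rule ccontr)
  assume "\<not> de_bruijn_erdos_property V E"
  then have few: "card (hlines V E) < card V" and nonuniv: "V \<notin> hlines V E"
    by (auto simp: de_bruijn_erdos_property_def)
  have "hlines V E \<subseteq> Pow V"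
    using hline_subset[OF assms(2)] by (auto simp: hlines_def)
  then have fin: "finite (hlines V E)" and sub: "\<And>L. L \<in> hlines V E \<Longrightarrow> L \<subseteq> V"
    using \<open>finite V\<close> by (auto intro: finite_subset)
  have all_lines: "hline E u ` (V - {u}) = hlines V E" if u: "u \<in> V" for u
  \<comment> \<open>There are at most \<open>card V - 1\<close> lines in total, so the equally many
    distinct lines through \<open>u\<close> exhaust them.\<close>
  proof (rule card_seteq[OF fin])
    show "hline E u ` (V - {u}) \<subseteq> hlines V E"
      using u by (auto simp: hlines_def)
    have "inj_on (hline E u) (V - {u})"
    proof (rule inj_onI, rule ccontr)
      fix v w
      assume *: "v \<in> V - {u}" "w \<in> V - {u}" "hline E u v = hline E u w" "v \<noteq> w"
      then have "hline E v w = V"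
        using u assms(4) by (intro hline_eq_imp_universal[OF assms(2), of u]) auto
      then show False
        using nonuniv * by (auto simp: hlines_def)
    qed
    then have "card (hline E u ` (V - {u})) = card V - 1"
      using u by (simp add: card_image card_Diff_singleton)
    then show "card (hlines V E) \<le> card (hline E u ` (V - {u}))"
      using few by simp
  qed
  obtain a b where "a \<in> V" "b \<in> V" "a \<noteq> b"
    using assms(3) by (metis card_le_Suc0_iff_eq assms(1) not_less_eq_eq numeral_2_eq_2)
  then have ab: "hline E a b \<in> hlines V E"
    by (auto simp: hlines_def)
  \<comment> \<open>By \<open>all_lines\<close> for this \<open>u\<close>, the fixed line
    \<open>ab\<close> is also some line \<open>uv\<close>, and so contains \<open>u\<close>.\<close>
  have "u \<in> hline E a b" if "u \<in> V" for u
    using ab all_lines[OF that, symmetric] by (auto simp: hline_def)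
  then have "hline E a b = V"
    using sub[OF ab] by auto
  then show False
    using ab nonuniv by simp
qed

end
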